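(* Let $X$ and $Y$ be Banach spaces over $\mathbb{K}$ ($\mathbb{K}=\mathbb{R}$ or $\mathbb{C}$). (a) If $X$ is reflexive, then $\mathrm{NA}(X,Y^* )=\mathrm{QNA}(X,Y^* )=w^*\mathrm{QNA}(X,Y^* )$. (b) If $Y$ is reflexive, then $\mathrm{QNA}(X,Y^* )=w^*\mathrm{QNA}(X,Y^* )$.
   Context: Banach spaces are over $\mathbb{K}=\mathbb{R}$ or $\mathbb{C}$. $B_X$ is the closed unit ball of $X$, $X^*$ its topological dual, and $\mathcal{L}(X,Y)$ the space of bounded linear operators from $X$ to $Y$ with the operator norm. For $T\in\mathcal{L}(X,Y^* )$: $T\in\mathrm{NA}(X,Y^* )$ if there is $x\in B_X$ with $\|Tx\|=\|T\|$; $T\in\mathrm{QNA}(X,Y^* )$ if the norm closure of $T(B_X)$ intersects the sphere $\{u^*\in Y^*:\|u^*\|=\|T\|\}$; $T\in w^*\mathrm{QNA}(X,Y^* )$ if the $\sigma(Y^*,Y)$-closure of $T(B_X)$ intersects the sphere $\{u^*\in Y^*:\|u^*\|=\|T\|\}$. *)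

theory Defs
  imports "HOL-Analysis.Analysis"
begin

text \<open>
  The library's normed spaces are real. A normed space over \<open>\<bbbK>\<close> is therefore a
  \<open>real_normed_vector\<close> type together with a scalar multiplication \<open>s\<close> by \<open>\<bbbK>\<close> that extends the
  real one and for which the norm is homogeneous; it is a Banach space if the type is of class
  \<open>banach\<close>. For \<open>\<bbbK> = \<real>\<close> the only such \<open>s\<close> is \<open>scaleR\<close>.
\<close>

locale normed_space_over = vector_space s
  for s :: "'k::real_normed_field \<Rightarrow> 'a::real_normed_vector \<Rightarrow> 'a" +
  assumes scale_of_real: "s (of_real r) x = r *\<^sub>R x"
    and norm_scale: "norm (s c x) = norm c * norm x"

lemma normed_space_over_scaleR:
  "normed_space_over (scaleR :: real \<Rightarrow> 'a::real_normed_vector \<Rightarrow> 'a)"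
  by unfold_locales (simp_all add: scaleR_add_left scaleR_add_right)

lemma normed_space_over_real_iff:
  fixes s :: "real \<Rightarrow> 'a::real_normed_vector \<Rightarrow> 'a"
  shows "normed_space_over s \<longleftrightarrow> s = scaleR"
proof
  assume "normed_space_over s"
  then interpret normed_space_over s .
  show "s = scaleR"
    using scale_of_real by (auto simp: fun_eq_iff)
qed (simp add: normed_space_over_scaleR)

lemma normed_space_over_times:
  "normed_space_over (times :: 'k::real_normed_field \<Rightarrow> 'k \<Rightarrow> 'k)"
  by unfold_locales (simp_all add: algebra_simps norm_mult scaleR_conv_of_real)

text \<open>
  \<open>dual s\<close> is the topological dual over \<open>\<bbbK>\<close>: a set of bounded real-linear maps, namely those that
  are \<open>\<bbbK>\<close>-linear. It inherits the norm of the type \<open>'a \<Rightarrow>\<^sub>L 'k\<close>, which is the operator norm.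
\<close>

definition dual :: "('k::real_normed_field \<Rightarrow> 'a::real_normed_vector \<Rightarrow> 'a) \<Rightarrow> ('a \<Rightarrow>\<^sub>L 'k) set"
  where "dual s = {f :: 'a \<Rightarrow>\<^sub>L 'k. \<forall>c x. f (s c x) = c * f x}"

definition dual_scale :: "'k::real_normed_field \<Rightarrow> ('a::real_normed_vector \<Rightarrow>\<^sub>L 'k) \<Rightarrow> ('a \<Rightarrow>\<^sub>L 'k)"
  where "dual_scale c f = blinfun_mult_right c o\<^sub>L f"

lemma dual_scale_apply [simp]: "dual_scale c f x = c * f x"
  by (simp add: dual_scale_def)

text \<open>
  The dual of \<open>dual s\<close>. Its elements matter only through their values on \<open>dual s\<close>.
\<close>

definition bidual ::
    "('k::real_normed_field \<Rightarrow> 'a::real_normed_vector \<Rightarrow> 'a) \<Rightarrow> (('a \<Rightarrow>\<^sub>L 'k) \<Rightarrow> 'k) set"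
  where "bidual s = {\<phi>.
    (\<forall>f\<in>dual s. \<forall>g\<in>dual s. \<phi> (f + g) = \<phi> f + \<phi> g) \<and>
    (\<forall>c. \<forall>f\<in>dual s. \<phi> (dual_scale c f) = c * \<phi> f) \<and>
    (\<exists>M. \<forall>f\<in>dual s. norm (\<phi> f) \<le> M * norm f)}"

text \<open>Surjectivity of the canonical embedding into the bidual.\<close>

definition reflexive :: "('k::real_normed_field \<Rightarrow> 'a::real_normed_vector \<Rightarrow> 'a) \<Rightarrow> bool"
  where "reflexive s \<longleftrightarrow> (\<forall>\<phi>\<in>bidual s. \<exists>x. \<forall>f\<in>dual s. \<phi> f = blinfun_apply f x)"

text \<open>
  The topology \<open>\<sigma>(Y\<^sup>*, Y)\<close>: the coarsest one on the dual for which evaluation at every point is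
  continuous. Here \<open>euclidean\<close> is the product topology on the functions \<open>'a \<Rightarrow> 'k\<close>.
\<close>

definition weak_star_topology ::
    "('k::real_normed_field \<Rightarrow> 'a::real_normed_vector \<Rightarrow> 'a) \<Rightarrow> ('a \<Rightarrow>\<^sub>L 'k) topology"
  where "weak_star_topology s = pullback_topology (dual s) blinfun_apply euclidean"

text \<open>\<open>\<L>(X, Y\<^sup>*)\<close>, for \<open>X\<close> and \<open>Y\<close> given by \<open>sX\<close> and \<open>sY\<close>.\<close>

definition ops_to_dual ::
    "('k::real_normed_field \<Rightarrow> 'x::real_normed_vector \<Rightarrow> 'x) \<Rightarrow>
     ('k \<Rightarrow> 'y::real_normed_vector \<Rightarrow> 'y) \<Rightarrow> ('x \<Rightarrow>\<^sub>L ('y \<Rightarrow>\<^sub>L 'k)) set"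
  where "ops_to_dual sX sY =
    {T :: 'x \<Rightarrow>\<^sub>L ('y \<Rightarrow>\<^sub>L 'k). (\<forall>x. T x \<in> dual sY) \<and> (\<forall>c x. T (sX c x) = dual_scale c (T x))}"

definition NA ::
    "('k::real_normed_field \<Rightarrow> 'x::real_normed_vector \<Rightarrow> 'x) \<Rightarrow>
     ('k \<Rightarrow> 'y::real_normed_vector \<Rightarrow> 'y) \<Rightarrow> ('x \<Rightarrow>\<^sub>L ('y \<Rightarrow>\<^sub>L 'k)) set"
  where "NA sX sY = {T \<in> ops_to_dual sX sY. \<exists>x\<in>cball 0 1. norm (T x) = norm T}"

text \<open>
  The norm closure may be taken in the whole type, since \<open>dual sY\<close> is norm closed.
\<close>

definition QNA ::
    "('k::real_normed_field \<Rightarrow> 'x::real_normed_vector \<Rightarrow> 'x) \<Rightarrow>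
     ('k \<Rightarrow> 'y::real_normed_vector \<Rightarrow> 'y) \<Rightarrow> ('x \<Rightarrow>\<^sub>L ('y \<Rightarrow>\<^sub>L 'k)) set"
  where "QNA sX sY = {T \<in> ops_to_dual sX sY.
    closure (blinfun_apply T ` cball 0 1) \<inter> {u \<in> dual sY. norm u = norm T} \<noteq> {}}"

definition wstar_QNA ::
    "('k::real_normed_field \<Rightarrow> 'x::real_normed_vector \<Rightarrow> 'x) \<Rightarrow>
     ('k \<Rightarrow> 'y::real_normed_vector \<Rightarrow> 'y) \<Rightarrow> ('x \<Rightarrow>\<^sub>L ('y \<Rightarrow>\<^sub>L 'k)) set"
  where "wstar_QNA sX sY = {T \<in> ops_to_dual sX sY.
    (weak_star_topology sY closure_of (blinfun_apply T ` cball 0 1))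
      \<inter> {u \<in> dual sY. norm u = norm T} \<noteq> {}}"

end

theory Submission
  imports Defs
begin

text \<open>
  Let \<open>u\<close> lie in the weak-star closure of \<open>T(B\<^sub>X)\<close> with \<open>norm u = norm T\<close>.

  If \<open>X\<close> is reflexive: by Tychonoff, \<open>u\<close> is the image, under the extension of \<open>T\<close> to the bidual, of a
  functional \<open>\<phi>\<close> of norm at most 1 on the dual of \<open>X\<close>. By reflexivity \<open>\<phi>\<close> is evaluation at some \<open>x\<close>,
  so \<open>u = T x\<close>, and \<open>norm x \<le> 1\<close> by Hahn-Banach.

  If \<open>Y\<close> is reflexive and \<open>u\<close> is not in the norm closure: by Hahn-Banach a functional on the dual of
  \<open>Y\<close> strictly separates \<open>u\<close> from the absolutely convex set \<open>T(B\<^sub>X)\<close>. By reflexivity it is evaluation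
  at a point of \<open>Y\<close>, hence weak-star continuous, a contradiction.

  Hahn-Banach itself follows from Zorn's lemma, because minimal sublinear functionals are linear.
\<close>

section \<open>Norming functionals\<close>

text \<open>Fix \<open>i\<close>, take the infimum over \<open>j\<close>, then the one over
  \<open>i\<close>. Letting \<open>k\<close> depend on \<open>i\<close> and \<open>j\<close> covers
  chains (the smaller of two functionals) as well as families whose parameters add.\<close>

lemma INF_add_le:
  fixes F :: "'i \<Rightarrow> 'a \<Rightarrow> real"
  assumes "I \<noteq> {}" and bdd: "\<And>z. bdd_below ((\<lambda>i. F i z) ` I)"
    and dir: "\<And>i j. i \<in> I \<Longrightarrow> j \<in> I \<Longrightarrow> \<exists>k\<in>I. F k x \<le> F i y + F j z"
  shows "(INF i\<in>I. F i x) \<le> (INF i\<in>I. F i y) + (INF i\<in>I. F i z)"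
proof -
  have 1: "(INF k\<in>I. F k x) - F i y \<le> F j z" if ij: "i \<in> I" "j \<in> I" for i j
  proof -
    obtain k where "k \<in> I" "F k x \<le> F i y + F j z"
      using dir[OF ij] by blast
    then show ?thesis
      using cINF_lower[OF bdd, of k x] by linarith
  qed
  have 2: "(INF k\<in>I. F k x) - (INF j\<in>I. F j z) \<le> F i y" if "i \<in> I" for i
  proof -
    have "(INF k\<in>I. F k x) - F i y \<le> (INF j\<in>I. F j z)"
      by (rule cINF_greatest[OF assms(1) 1[OF that]])
    then show ?thesis
      by linarith
  qed
  have "(INF k\<in>I. F k x) - (INF j\<in>I. F j z) \<le> (INF i\<in>I. F i y)"
    by (rule cINF_greatest[OF assms(1) 2])
  then show ?thesis
    by linarith
qed

lemma INF_le_mult: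
  fixes F :: "'i \<Rightarrow> 'a \<Rightarrow> real"
  assumes "I \<noteq> {}" and bdd: "\<And>z. bdd_below ((\<lambda>i. F i z) ` I)" and "0 < r"
    and dir: "\<And>i. i \<in> I \<Longrightarrow> \<exists>k\<in>I. F k x \<le> r * F i y"
  shows "(INF i\<in>I. F i x) \<le> r * (INF i\<in>I. F i y)"
proof -
  have "(INF k\<in>I. F k x) / r \<le> F i y" if i: "i \<in> I" for i
  proof -
    obtain k where "k \<in> I" "F k x \<le> r * F i y"
      using dir[OF i] by blast
    then have "(INF k\<in>I. F k x) \<le> r * F i y"
      using cINF_lower[OF bdd, of k x] by linarith
    then show ?thesis
      using \<open>0 < r\<close> by (simp add: field_simps)
  qed
  from cINF_greatest[OF assms(1) this] show ?thesis
    using \<open>0 < r\<close> by (simp add: field_simps)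
qed

section \<open>Sublinear functionals and the Hahn-Banach theorem\<close>

definition sublinear :: "('a::real_vector \<Rightarrow> real) \<Rightarrow> bool"
  where "sublinear q \<longleftrightarrow>
    (\<forall>x y. q (x + y) \<le> q x + q y) \<and> (\<forall>r x. 0 \<le> r \<longrightarrow> q (r *\<^sub>R x) = r * q x)"

lemma sublinear_add: "sublinear q \<Longrightarrow> q (x + y) \<le> q x + q y"
  and sublinear_scaleR: "sublinear q \<Longrightarrow> 0 \<le> r \<Longrightarrow> q (r *\<^sub>R x) = r * q x"
  by (auto simp: sublinear_def)

lemma sublinear_0: "sublinear q \<Longrightarrow> q 0 = 0"
  using sublinear_scaleR[of q 0 0] by simp

lemma sublinear_minus: "sublinear q \<Longrightarrow> - q (- x) \<le> q x"
  using sublinear_add[of q x "- x"] by (simp add: sublinear_0)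

text \<open>Equality follows from the one-sided estimate by applying it also to
  \<open>inverse r\<close> and \<open>r *\<^sub>R x\<close>.\<close>

lemma sublinearI:
  assumes "\<And>x y. q (x + y) \<le> q x + q y" and "q 0 = 0"
    and le: "\<And>r x. 0 < r \<Longrightarrow> q (r *\<^sub>R x) \<le> r * q x"
  shows "sublinear q"
proof -
  have "q (r *\<^sub>R x) = r * q x" if "0 < r" for r x
  proof (rule antisym)
    have "q x \<le> inverse r * q (r *\<^sub>R x)"
      using le[of "inverse r" "r *\<^sub>R x"] that by simp
    then show "r * q x \<le> q (r *\<^sub>R x)"
      using that by (simp add: field_simps)
  qed (use le that in blast)
  then have "q (r *\<^sub>R x) = r * q x" if "0 \<le> r" for r x
    using that \<open>q 0 = 0\<close> by (cases "r = 0") auto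
  then show ?thesis
    using assms(1) by (simp add: sublinear_def)
qed

text \<open>Provides the lower bound for Zorn's lemma. The infimum is finite because every member
  satisfies \<open>- p (- z) \<le> - c (- z) \<le> c z\<close>.\<close>

lemma sublinear_INF_chain:
  assumes "C \<noteq> {}" and subl: "\<And>c. c \<in> C \<Longrightarrow> sublinear c" and le: "\<And>c. c \<in> C \<Longrightarrow> c \<le> p"
    and chain: "\<And>c d. c \<in> C \<Longrightarrow> d \<in> C \<Longrightarrow> c \<le> d \<or> d \<le> c"
  shows "bdd_below ((\<lambda>c. c z) ` C)" and "sublinear (\<lambda>z. INF c\<in>C. c z)"
proof -
  show bdd: "bdd_below ((\<lambda>c. c z) ` C)" for z
  proof (rule bdd_belowI2)
    fix c assume c: "c \<in> C"
    show "- p (- z) \<le> c z"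
      using sublinear_minus[OF subl[OF c], of z] le_funD[OF le[OF c], of "- z"] by linarith
  qed
  show "sublinear (\<lambda>z. INF c\<in>C. c z)"
  proof (rule sublinearI)
    fix x y
    show "(INF c\<in>C. c (x + y)) \<le> (INF c\<in>C. c x) + (INF c\<in>C. c y)"
    proof (rule INF_add_le[OF assms(1) bdd])
      fix c d assume cd: "c \<in> C" "d \<in> C"
      then consider "c \<le> d" | "d \<le> c"
        using chain by blast
      then show "\<exists>k\<in>C. k (x + y) \<le> c x + d y"
      proof cases
        case 1
        then show ?thesis
          using cd sublinear_add[OF subl[OF cd(1)], of x y] le_funD[of c d y] by (intro bexI[of _ c]) linarith+
      next
        case 2
        then show ?thesis
          using cd sublinear_add[OF subl[OF cd(2)], of x y] le_funD[of d c x] by (intro bexI[of _ d]) linarith+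
      qed
    qed
  next
    show "(INF c\<in>C. c 0) = 0"
      using assms(1) subl by (simp add: sublinear_0 cong: INF_cong)
  next
    fix r :: real and x :: 'a assume r: "0 < r"
    show "(INF c\<in>C. c (r *\<^sub>R x)) \<le> r * (INF c\<in>C. c x)"
      by (rule INF_le_mult[OF assms(1) bdd r]) (use r subl in \<open>force simp: sublinear_scaleR\<close>)
  qed
qed

lemma ex_minimal_sublinear:
  assumes "sublinear p"
  obtains q where "sublinear q" "q \<le> p" "\<And>q'. sublinear q' \<Longrightarrow> q' \<le> q \<Longrightarrow> q' = q"
proof -
  let ?A = "{q. sublinear q \<and> q \<le> p}"
  have "\<exists>m\<in>?A. \<forall>a\<in>?A. a \<le> m \<longrightarrow> a = m"
  \<comment> \<open>The order is reversed, so the maximal element from Zorn's lemma is a minimal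
    functional.\<close>
  proof (rule predicate_Zorn[where P = "\<lambda>a b. b \<le> a"])
    show "partial_order_on ?A (relation_of (\<lambda>a b. b \<le> a) ?A)"
      by (rule partial_order_on_relation_ofI) auto
  next
    fix C assume C: "C \<in> Chains (relation_of (\<lambda>a b. b \<le> a) ?A)"
    show "\<exists>u\<in>?A. \<forall>a\<in>C. u \<le> a"
    proof (cases "C = {}")
      case True
      then show ?thesis
        using assms by auto
    next
      case False
      have sub: "C \<subseteq> ?A"
        using Chains_relation_of[OF C] .
      have subl: "\<And>c. c \<in> C \<Longrightarrow> sublinear c" and le: "\<And>c. c \<in> C \<Longrightarrow> c \<le> p"
        using sub by auto
      have chain: "\<And>c d. c \<in> C \<Longrightarrow> d \<in> C \<Longrightarrow> c \<le> d \<or> d \<le> c"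
        using C by (auto simp: Chains_def relation_of_def)
      note inf = sublinear_INF_chain[OF False subl le chain]
      have lower: "(\<lambda>z. INF c\<in>C. c z) \<le> c" if "c \<in> C" for c
        using that by (auto intro!: le_funI cINF_lower inf(1))
      obtain c where c: "c \<in> C"
        using False by blast
      then have "(\<lambda>z. INF c\<in>C. c z) \<le> p"
        using lower[OF c] sub by (auto intro: order_trans)
      then show ?thesis
        using inf(2) lower by blast
    qed
  qed
  then show thesis
    using that by (auto intro: order_trans)
qed

text \<open>
  Replacing \<open>q z\<close> by the infimum of \<open>q (z + t *\<^sub>R x) - t * q x\<close> over \<open>t \<ge> 0\<close> forces equality in
  \<open>- q x \<le> q' (- x)\<close>. This makes minimal sublinear functionals odd, and turns \<open>p\<close> into one whose
  linear minorants are norming at \<open>x\<close>.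
\<close>

lemma sublinear_slide:
  fixes q :: "'a::real_vector \<Rightarrow> real"
  assumes q: "sublinear q"
  obtains q' where "sublinear q'" "q' \<le> q" "q' (- x) \<le> - q x"
proof -
  define F where "F = (\<lambda>t z. q (z + t *\<^sub>R x) - t * q x)"
  define I where "I = {0::real..}"
  have ne: "I \<noteq> {}"
    by (auto simp: I_def)
  \<comment> \<open>Comes from \<open>t * q x = q (t *\<^sub>R x) \<le> q (z + t *\<^sub>R x) + q (-
    z)\<close>.\<close>
  have low: "- q (- z) \<le> F t z" if "t \<in> I" for t z
    using that sublinear_add[OF q, of "z + t *\<^sub>R x" "- z"] sublinear_scaleR[OF q, of t x]
    by (simp add: F_def I_def)
  have bdd: "bdd_below ((\<lambda>t. F t z) ` I)" for z
    using low by (rule bdd_belowI2)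
  have lower: "(INF t\<in>I. F t z) \<le> F t z" if "t \<ge> 0" for t z
    using that by (intro cINF_lower bdd) (simp add: I_def)
  show thesis
  proof (rule that)
    show "sublinear (\<lambda>z. INF t\<in>I. F t z)"
    proof (rule sublinearI)
      fix y z
      show "(INF t\<in>I. F t (y + z)) \<le> (INF t\<in>I. F t y) + (INF t\<in>I. F t z)"
      proof (rule INF_add_le[OF ne bdd])
        fix s t assume "s \<in> I" "t \<in> I"
        moreover have "F (s + t) (y + z) \<le> F s y + F t z"
          using sublinear_add[OF q, of "y + s *\<^sub>R x" "z + t *\<^sub>R x"]
          by (simp add: F_def algebra_simps)
        ultimately show "\<exists>k\<in>I. F k (y + z) \<le> F s y + F t z"
          by (intro bexI[of _ "s + t"]) (auto simp: I_def)
      qed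
    next
      have "F t 0 = 0" if "t \<in> I" for t
        using that sublinear_scaleR[OF q, of t x] by (simp add: F_def I_def)
      then show "(INF t\<in>I. F t 0) = 0"
        using ne by (simp cong: INF_cong)
    next
      fix r :: real and z :: 'a assume r: "0 < r"
      show "(INF t\<in>I. F t (r *\<^sub>R z)) \<le> r * (INF t\<in>I. F t z)"
      proof (rule INF_le_mult[OF ne bdd r])
        fix t assume "t \<in> I"
        moreover have "F (r * t) (r *\<^sub>R z) = r * F t z"
          using r sublinear_scaleR[OF q, of r "z + t *\<^sub>R x"] by (simp add: F_def algebra_simps)
        ultimately show "\<exists>k\<in>I. F k (r *\<^sub>R z) \<le> r * F t z"
          using r by (intro bexI[of _ "r * t"]) (auto simp: I_def)
      qed
    qed
    \<comment> \<open>Parameter 0 gives \<open>q' \<le> q\<close>; parameter 1 gives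
      \<open>q' (- x) \<le> q 0 - q x\<close>.\<close>
    show "(\<lambda>z. INF t\<in>I. F t z) \<le> q"
      using lower[of 0] by (auto simp: le_fun_def F_def)
    show "(INF t\<in>I. F t (- x)) \<le> - q x"
      using lower[of 1 "- x"] by (simp add: F_def sublinear_0[OF q])
  qed
qed

text \<open>Sliding cannot lower a minimal functional, so \<open>q\<close> is odd; subadditivity at
  \<open>- x\<close> and \<open>- y\<close> is then the reverse inequality at \<open>x\<close> and
  \<open>y\<close>.\<close>

lemma minimal_sublinear_linear:
  fixes q :: "'a::real_vector \<Rightarrow> real"
  assumes q: "sublinear q" and min: "\<And>q'. sublinear q' \<Longrightarrow> q' \<le> q \<Longrightarrow> q' = q"
  shows "linear q"
proof -
  have neg: "q (- x) = - q x" for x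
  proof -
    obtain q' where "sublinear q'" "q' \<le> q" "q' (- x) \<le> - q x"
      using sublinear_slide[OF q] .
    then have "q (- x) \<le> - q x"
      using min by metis
    then show ?thesis
      using sublinear_minus[OF q, of x] by linarith
  qed
  show ?thesis
  proof (rule linearI)
    fix x y
    show "q (x + y) = q x + q y"
      using sublinear_add[OF q, of x y] sublinear_add[OF q, of "- x" "- y"] neg[of x] neg[of y] neg[of "x + y"]
      by simp
  next
    fix r x
    show "q (r *\<^sub>R x) = r *\<^sub>R q x"
      using sublinear_scaleR[OF q, of r x] sublinear_scaleR[OF q, of "- r" x] neg[of "r *\<^sub>R x"]
      by (cases "0 \<le> r") auto
  qed
qed

text \<open>Sliding at \<open>u\<close> comes before minimising: a linear \<open>f\<close> below the
  slid functional has \<open>- f u = f (- u) \<le> - p u\<close>, which forces equality at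
  \<open>u\<close>.\<close>

theorem hahn_banach_sublinear:
  fixes p :: "'a::real_vector \<Rightarrow> real"
  assumes "sublinear p"
  obtains f where "linear f" "\<And>x. f x \<le> p x" "f u = p u"
proof -
  obtain p' where p': "sublinear p'" "p' \<le> p" "p' (- u) \<le> - p u"
    using sublinear_slide[OF assms] .
  obtain q where q: "sublinear q" "q \<le> p'" "\<And>q'. sublinear q' \<Longrightarrow> q' \<le> q \<Longrightarrow> q' = q"
    using ex_minimal_sublinear[OF p'(1)] by blast
  have lin: "linear q"
    using minimal_sublinear_linear[OF q(1,3)] .
  have le: "q x \<le> p x" for x
    using q(2) p'(2) by (auto simp: le_fun_def intro: order_trans)
  have "q (- u) \<le> - p u"
    using q(2) p'(3) by (auto simp: le_fun_def intro: order_trans)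
  then have "q u = p u"
    using le[of u] linear_neg[OF lin, of u] by simp
  then show thesis
    using that lin le by blast
qed

section \<open>Functionals dominated by a seminorm, over the real and complex numbers\<close>

definition seminorm_over :: "('k::real_normed_field \<Rightarrow> 'a::real_normed_vector \<Rightarrow> 'a) \<Rightarrow> ('a \<Rightarrow> real) \<Rightarrow> bool"
  where "seminorm_over s p \<longleftrightarrow>
    (\<forall>x y. p (x + y) \<le> p x + p y) \<and> (\<forall>c x. p (s c x) = norm c * p x)"

text \<open>The Hahn-Banach property as a predicate, so that later arguments treat both fields at
  once. \<open>f\<close> is a plain function because \<open>p\<close> may fail to be dominated by
  the norm.\<close>

definition norming :: "('k::real_normed_field \<Rightarrow> 'a::real_normed_vector \<Rightarrow> 'a) \<Rightarrow> bool"
  where "norming s \<longleftrightarrow> (\<forall>p u. seminorm_over s p \<longrightarrow>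
    (\<exists>f. (\<forall>x y. f (x + y) = f x + f y) \<and> (\<forall>c x. f (s c x) = c * f x) \<and>
      (\<forall>x. norm (f x) \<le> p x) \<and> f u = of_real (p u)))"

context normed_space_over
begin

lemma seminorm_over_sublinear:
  assumes "seminorm_over s p"
  shows "sublinear p"
  unfolding sublinear_def
proof (intro conjI allI impI)
  fix r :: real and x assume "0 \<le> r"
  then show "p (r *\<^sub>R x) = r * p x"
    using assms unfolding scale_of_real[symmetric] seminorm_over_def by simp
qed (use assms in \<open>simp add: seminorm_over_def\<close>)

lemma seminorm_over_norm: "seminorm_over s norm"
  by (simp add: seminorm_over_def norm_scale norm_triangle_ineq)

lemma bounded_linear_if_scale_linear:
  assumes "\<And>x y. f (x + y) = f x + f y" and "\<And>c x. f (s c x) = c * f x"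
    and "\<And>x. norm (f x) \<le> norm x * K"
  shows "bounded_linear f"
proof (rule bounded_linear_intro)
  fix r x
  show "f (r *\<^sub>R x) = r *\<^sub>R f x"
    using assms(2)[of "of_real r" x] by (simp add: scale_of_real scaleR_conv_of_real)
qed (use assms in auto)

end

text \<open>A seminorm is even, so the one-sided bound \<open>f x \<le> p x\<close> also bounds the
  absolute value.\<close>

lemma norming_real:
  fixes s :: "real \<Rightarrow> 'a::real_normed_vector \<Rightarrow> 'a"
  assumes "normed_space_over s"
  shows "norming s"
  unfolding norming_def
proof (intro allI impI)
  fix p :: "'a \<Rightarrow> real" and u
  assume p: "seminorm_over s p"
  interpret normed_space_over s by fact
  have s: "s = scaleR"
    using assms by (simp add: normed_space_over_real_iff)
  obtain f where f: "linear f" "\<And>x. f x \<le> p x" "f u = p u"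
    using hahn_banach_sublinear[OF seminorm_over_sublinear[OF p]] by blast
  have "norm (f x) \<le> p x" for x
  proof -
    have "p (s c x) = norm c * p x" for c
      using p by (simp add: seminorm_over_def)
    from this[of "- 1"] have "p (- x) = p x"
      by simp
    then show ?thesis
      using f(2)[of x] f(2)[of "- x"] by (simp add: linear_neg[OF f(1)])
  qed
  then show "\<exists>f. (\<forall>x y. f (x + y) = f x + f y) \<and> (\<forall>c x. f (s c x) = c * f x) \<and>
      (\<forall>x. norm (f x) \<le> p x) \<and> f u = of_real (p u)"
    using f by (intro exI[of _ f]) (simp add: s linear_add linear_scale)
qed

text \<open>Bohnenblust-Sobczyk: the real functional \<open>g\<close> is the real part of a complex
  functional, recovered from \<open>g x\<close> and \<open>g (s \<i> x)\<close>.\<close>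

lemma norming_complex:
  fixes s :: "complex \<Rightarrow> 'a::real_normed_vector \<Rightarrow> 'a"
  assumes "normed_space_over s"
  shows "norming s"
  unfolding norming_def
proof (intro allI impI)
  fix p :: "'a \<Rightarrow> real" and u
  assume p: "seminorm_over s p"
  interpret normed_space_over s by fact
  obtain g where g: "linear g" "\<And>x. g x \<le> p x" "g u = p u"
    using hahn_banach_sublinear[OF seminorm_over_sublinear[OF p]] by blast
  define f where "f x = Complex (g x) (- g (s \<i> x))" for x
  have add: "f (x + y) = f x + f y" for x y
    by (simp add: f_def complex_eq_iff scale_right_distrib linear_add[OF g(1)])
  have scale: "f (s c x) = c * f x" for c x
  proof -
    have 1: "s c x = Re c *\<^sub>R x + Im c *\<^sub>R s \<i> x"
      unfolding scale_of_real[symmetric] scale_scale scale_left_distrib[symmetric]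
      by (rule arg_cong[of _ _ "\<lambda>c. s c x"]) (simp add: complex_eq_iff)
    have 2: "s \<i> (s c x) = Re c *\<^sub>R s \<i> x - Im c *\<^sub>R x"
      unfolding scale_of_real[symmetric] scale_scale scale_left_diff_distrib[symmetric]
      by (rule arg_cong[of _ _ "\<lambda>c. s c x"]) (simp add: complex_eq_iff)
    have "g (s c x) = Re c * g x + Im c * g (s \<i> x)"
      unfolding 1 by (simp add: linear_add[OF g(1)] linear_scale[OF g(1)])
    moreover have "g (s \<i> (s c x)) = Re c * g (s \<i> x) - Im c * g x"
      unfolding 2 by (simp add: linear_diff[OF g(1)] linear_scale[OF g(1)])
    ultimately show ?thesis
      by (simp add: f_def complex_eq_iff)
  qed
  have le: "norm (f x) \<le> p x" for x
  proof (cases "f x = 0")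
    case True
    have "p (s c x) = norm c * p x" for c
      using p by (simp add: seminorm_over_def)
    \<comment> \<open>Non-negativity comes from
      \<open>0 = p 0 \<le> p x + p (- x) = 2 * p x\<close>.\<close>
    from this[of 0] this[of "- 1"] have "0 \<le> p x"
      using sublinear_add[OF seminorm_over_sublinear[OF p], of x "- x"] by simp
    then show ?thesis
      using True by simp
  next
    case False
    \<comment> \<open>The unimodular \<open>c\<close> rotates \<open>f x\<close> to the positive
      real \<open>norm (f x)\<close>, where the bound on \<open>g\<close>, the real part of
      \<open>f\<close>, applies.\<close>
    define c where "c = cnj (f x) / norm (f x)"
    have c: "norm c = 1" "c * f x = norm (f x)"
      using False complex_norm_square[of "f x"]
      by (auto simp: c_def norm_divide field_simps power2_eq_square)
    have "norm (f x) = Re (f (s c x))"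
      unfolding scale c by simp
    also have "\<dots> \<le> p (s c x)"
      by (simp add: f_def g)
    also have "\<dots> = p x"
      using p c by (simp add: seminorm_over_def)
    finally show ?thesis .
  qed
  have "f u = of_real (p u)"
  proof -
    have re: "Re (f u) = p u"
      by (simp add: f_def g)
    then have "norm (f u) = Re (f u)"
      using le[of u] complex_Re_le_cmod[of "f u"] by linarith
    then have "Im (f u) = 0"
      using cmod_power2[of "f u"] by simp
    then show ?thesis
      using re by (simp add: complex_eq_iff)
  qed
  then show "\<exists>f. (\<forall>x y. f (x + y) = f x + f y) \<and> (\<forall>c x. f (s c x) = c * f x) \<and>
      (\<forall>x. norm (f x) \<le> p x) \<and> f u = of_real (p u)"
    using add scale le by blast
qed

section \<open>Weak-star closures\<close>

text \<open>Evaluations are weak-star continuous. This moves the closure into the space of all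
  functions with pointwise convergence, where Tychonoff applies.\<close>

lemma closure_of_weak_star_subset:
  assumes "u \<in> weak_star_topology s closure_of S"
  shows "blinfun_apply u \<in> closure (blinfun_apply ` S)"
proof -
  have "continuous_map (weak_star_topology s) euclidean (id \<circ> blinfun_apply)"
    unfolding weak_star_topology_def by (rule continuous_map_pullback) simp
  then show ?thesis
    using continuous_map_image_closure_subset[of "weak_star_topology s" euclidean blinfun_apply S] assms
    by auto
qed

text \<open>The norm topology is finer than pointwise convergence. The hypothesis on
  \<open>S\<close> keeps the approximating points in \<open>dual s\<close>, the underlying set of
  the weak-star topology.\<close>

lemma closure_subset_weak_star:
  fixes S :: "('a::real_normed_vector \<Rightarrow>\<^sub>L 'k::real_normed_field) set"
  assumes "u \<in> closure S" and "u \<in> dual s" and "S \<subseteq> dual s"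
  shows "u \<in> weak_star_topology s closure_of S"
proof -
  have cont: "continuous_on UNIV (blinfun_apply :: ('a \<Rightarrow>\<^sub>L 'k) \<Rightarrow> 'a \<Rightarrow> 'k)"
    by (intro continuous_on_coordinatewise_then_product continuous_intros)
  have "\<exists>y\<in>S. y \<in> blinfun_apply -` U \<inter> dual s" if "open U" "blinfun_apply u \<in> U" for U
  proof -
    have "open (blinfun_apply -` U :: ('a \<Rightarrow>\<^sub>L 'k) set)"
      using open_vimage[OF that(1) cont] .
    then have "S \<inter> blinfun_apply -` U \<noteq> {}"
      using assms(1) that(2) by (subst (asm) closure_iff_nhds_not_empty) auto
    then show ?thesis
      using assms(3) by auto
  qed
  then show ?thesis
    using assms(2)
    by (auto simp: weak_star_topology_def in_closure_of topspace_pullback_topology openin_pullback_topology)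
qed

section \<open>Inclusions without reflexivity\<close>

lemma NA_subset_QNA: "NA sX sY \<subseteq> QNA sX sY"
proof
  fix T assume "T \<in> NA sX sY"
  then obtain x where T: "T \<in> ops_to_dual sX sY" and x: "x \<in> cball 0 1" "norm (T x) = norm T"
    unfolding NA_def by blast
  have "T x \<in> closure (blinfun_apply T ` cball 0 1)"
    using x(1) by (intro subsetD[OF closure_subset] imageI)
  moreover have "T x \<in> dual sY"
    using T by (simp add: ops_to_dual_def)
  ultimately show "T \<in> QNA sX sY"
    using T x(2) unfolding QNA_def by blast
qed

lemma QNA_subset_wstar_QNA: "QNA sX sY \<subseteq> wstar_QNA sX sY"
proof
  fix T assume "T \<in> QNA sX sY"
  then obtain u where T: "T \<in> ops_to_dual sX sY" and u: "u \<in> closure (blinfun_apply T ` cball 0 1)"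
    "u \<in> dual sY" "norm u = norm T"
    unfolding QNA_def by blast
  have "blinfun_apply T ` cball 0 1 \<subseteq> dual sY"
    using T by (auto simp: ops_to_dual_def)
  then have "u \<in> weak_star_topology sY closure_of (blinfun_apply T ` cball 0 1)"
    by (rule closure_subset_weak_star[OF u(1,2)])
  then show "T \<in> wstar_QNA sX sY"
    using T u(2,3) unfolding wstar_QNA_def by blast
qed

section \<open>Weak-star limits when the domain is reflexive\<close>

text \<open>The adjoint of \<open>T\<close> applied to evaluation at \<open>y\<close>.\<close>

definition eval_comp ::
    "('x::real_normed_vector \<Rightarrow>\<^sub>L ('y::real_normed_vector \<Rightarrow>\<^sub>L 'k::real_normed_field)) \<Rightarrow> 'y \<Rightarrow> ('x \<Rightarrow>\<^sub>L 'k)"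
  where "eval_comp T y = Blinfun (\<lambda>x. T x y)"

lemma eval_comp_apply [simp]: "blinfun_apply (eval_comp T y) x = T x y"
proof -
  have "bounded_linear (\<lambda>x. T x y)"
    using bounded_linear_compose[OF blinfun.bounded_linear_left blinfun.bounded_linear_right] .
  then show ?thesis
    by (simp add: eval_comp_def bounded_linear_Blinfun_apply)
qed

text \<open>Banach-Alaoglu: a closed subset of a product of balls of the field, compact by
  Tychonoff.\<close>

lemma compact_contractive_functionals:
  "compact {\<phi> :: ('x::real_normed_vector \<Rightarrow>\<^sub>L 'k::{real_normed_field,heine_borel}) \<Rightarrow> 'k.
    (\<forall>f g. \<phi> (f + g) = \<phi> f + \<phi> g) \<and> (\<forall>c f. \<phi> (dual_scale c f) = c * \<phi> f) \<and>
    (\<forall>f. norm (\<phi> f) \<le> norm f)}" (is "compact ?K")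
proof -
  let ?P = "PiE UNIV (\<lambda>f :: 'x \<Rightarrow>\<^sub>L 'k. cball (0::'k) (norm f))"
  let ?A = "{\<phi> :: ('x \<Rightarrow>\<^sub>L 'k) \<Rightarrow> 'k. \<forall>f g. \<phi> (f + g) = \<phi> f + \<phi> g}"
  let ?S = "{\<phi> :: ('x \<Rightarrow>\<^sub>L 'k) \<Rightarrow> 'k. \<forall>c f. \<phi> (dual_scale c f) = c * \<phi> f}"
  have "compactin (product_topology (\<lambda>i. euclidean) UNIV) ?P"
    unfolding compactin_PiE by simp
  then have "compact ?P"
    by (simp add: euclidean_product_topology)
  moreover have "closed ?A" "closed ?S"
    by (intro closed_Collect_all closed_Collect_eq continuous_intros continuous_on_product_coordinates)+
  ultimately have "compact (?P \<inter> (?A \<inter> ?S))"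
    by (intro compact_Int_closed closed_Int)
  also have "?P \<inter> (?A \<inter> ?S) = ?K"
    by (auto simp: PiE_def Pi_def)
  finally show ?thesis .
qed

lemma wstar_closure_exists_functional:
  fixes T :: "'x::real_normed_vector \<Rightarrow>\<^sub>L ('y::real_normed_vector \<Rightarrow>\<^sub>L 'k::{real_normed_field,heine_borel})"
  assumes "blinfun_apply u \<in> closure (blinfun_apply ` blinfun_apply T ` cball 0 1)"
  obtains \<phi> :: "('x \<Rightarrow>\<^sub>L 'k) \<Rightarrow> 'k"
  where "\<And>f g. \<phi> (f + g) = \<phi> f + \<phi> g" "\<And>c f. \<phi> (dual_scale c f) = c * \<phi> f"
    "\<And>f. norm (\<phi> f) \<le> norm f" "\<And>y. u y = \<phi> (eval_comp T y)"
proof -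
  let ?K = "{\<phi> :: ('x \<Rightarrow>\<^sub>L 'k) \<Rightarrow> 'k.
    (\<forall>f g. \<phi> (f + g) = \<phi> f + \<phi> g) \<and> (\<forall>c f. \<phi> (dual_scale c f) = c * \<phi> f) \<and>
    (\<forall>f. norm (\<phi> f) \<le> norm f)}"
  \<comment> \<open>\<open>R\<close> extends \<open>T\<close> from points to functionals: it sends
    evaluation at \<open>x\<close> to \<open>T x\<close>.\<close>
  define R where "R \<phi> y = \<phi> (eval_comp T y)" for \<phi> :: "('x \<Rightarrow>\<^sub>L 'k) \<Rightarrow> 'k" and y
  have "continuous_on UNIV R"
    unfolding R_def by (intro continuous_on_coordinatewise_then_product continuous_on_product_coordinates)
  then have "compact (R ` ?K)"
    using compact_continuous_image compact_contractive_functionals continuous_on_subset by blast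
  moreover have "Hausdorff_space (euclidean :: ('y \<Rightarrow> 'k) topology)"
    unfolding euclidean_product_topology[symmetric] Hausdorff_space_product_topology by simp
  ultimately have "closed (R ` ?K)"
    using compactin_imp_closedin[of "euclidean :: ('y \<Rightarrow> 'k) topology" "R ` ?K"] by simp
  moreover have "blinfun_apply ` blinfun_apply T ` cball 0 1 \<subseteq> R ` ?K"
  proof clarify
    fix x :: 'x assume x: "x \<in> cball 0 1"
    have "norm (blinfun_apply f x) \<le> norm f" for f :: "'x \<Rightarrow>\<^sub>L 'k"
      using norm_blinfun[of f x] mult_left_le[of "norm x" "norm f"] x by simp
    then have "(\<lambda>f. blinfun_apply f x) \<in> ?K"
      by (simp add: blinfun.add_left)
    moreover have "R (\<lambda>f. blinfun_apply f x) = blinfun_apply (T x)"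
      by (simp add: R_def fun_eq_iff)
    ultimately show "blinfun_apply (T x) \<in> R ` ?K"
      using imageI[of "\<lambda>f. blinfun_apply f x" ?K R] by simp
  qed
  \<comment> \<open>The image of \<open>?K\<close> under \<open>R\<close> is closed and contains
    every \<open>T x\<close> with \<open>x\<close> in the unit ball, hence also their pointwise
    limits.\<close>
  ultimately have "blinfun_apply u \<in> R ` ?K"
    using assms closure_minimal by blast
  then obtain \<phi> where "\<phi> \<in> ?K" "blinfun_apply u = R \<phi>"
    by blast
  then show thesis
    by (intro that[of \<phi>]) (auto simp: R_def)
qed

lemma wstar_QNA_subset_NA:
  fixes sX :: "'k::{real_normed_field,heine_borel} \<Rightarrow> 'x::real_normed_vector \<Rightarrow> 'x"
    and sY :: "'k \<Rightarrow> 'y::real_normed_vector \<Rightarrow> 'y"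
  assumes "normed_space_over sX" and "norming sX" and "reflexive sX"
  shows "wstar_QNA sX sY \<subseteq> NA sX sY"
proof
  interpret normed_space_over sX by fact
  fix T assume "T \<in> wstar_QNA sX sY"
  then obtain u where T: "T \<in> ops_to_dual sX sY" and norm_u: "norm u = norm T"
    and u: "u \<in> weak_star_topology sY closure_of (blinfun_apply T ` cball 0 1)"
    unfolding wstar_QNA_def by blast
  obtain \<phi> :: "('x \<Rightarrow>\<^sub>L 'k) \<Rightarrow> 'k"
    where \<phi>: "\<And>f g. \<phi> (f + g) = \<phi> f + \<phi> g" "\<And>c f. \<phi> (dual_scale c f) = c * \<phi> f"
      "\<And>f. norm (\<phi> f) \<le> norm f" "\<And>y. u y = \<phi> (eval_comp T y)"
    using wstar_closure_exists_functional[OF closure_of_weak_star_subset[OF u]] by blast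
  have "\<phi> \<in> bidual sX"
    unfolding bidual_def using \<phi>(1-3) by (auto intro!: exI[of _ 1])
  then obtain x where x: "\<And>f. f \<in> dual sX \<Longrightarrow> \<phi> f = blinfun_apply f x"
    using \<open>reflexive sX\<close> unfolding reflexive_def by blast
  \<comment> \<open>\<open>\<phi>\<close> is known to be evaluation at \<open>x\<close> only on
    \<open>dual sX\<close>; homogeneity of \<open>T\<close> places \<open>eval_comp T y\<close>
    there.\<close>
  have "eval_comp T y \<in> dual sX" for y
    using T by (simp add: dual_def ops_to_dual_def)
  then have "u = T x"
    by (intro blinfun_eqI) (simp add: \<phi>(4) x)
  \<comment> \<open>Reflexivity gives no bound on \<open>x\<close>. A functional of norm at most 1
    with value \<open>norm x\<close> at \<open>x\<close> supplies it, since \<open>\<phi>\<close> is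
    contractive.\<close>
  obtain f where f: "\<And>y z. f (y + z) = f y + f z" "\<And>c z. f (sX c z) = c * f z"
    "\<And>z. norm (f z) \<le> norm z" "f x = of_real (norm x)"
    using \<open>norming sX\<close> seminorm_over_norm unfolding norming_def by blast
  have bl: "bounded_linear f"
    by (rule bounded_linear_if_scale_linear[where K = 1]) (use f in auto)
  then have "Blinfun f \<in> dual sX"
    using f(2) by (simp add: dual_def bounded_linear_Blinfun_apply)
  then have "norm x = norm (\<phi> (Blinfun f))"
    by (simp add: x bounded_linear_Blinfun_apply[OF bl] f(4))
  also have "\<dots> \<le> norm (Blinfun f)"
    by (rule \<phi>)
  also have "\<dots> \<le> 1"
    by (rule norm_blinfun_bound) (use f(3) in \<open>auto simp: bounded_linear_Blinfun_apply[OF bl]\<close>)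
  finally show "T \<in> NA sX sY"
    using T norm_u \<open>u = T x\<close> by (simp add: NA_def bexI[of _ x])
qed

section \<open>Separation from the image of the unit ball\<close>

text \<open>For nonzero \<open>c\<close> the lower bound is the upper bound for
  \<open>inverse c\<close>.\<close>

lemma norm_dual_scale: "norm (dual_scale c f) = norm c * norm f"
proof (cases "c = 0")
  case True
  then have "dual_scale c f = 0"
    by (intro blinfun_eqI) simp
  then show ?thesis
    using True by simp
next
  case False
  have le: "norm (dual_scale c f) \<le> norm c * norm f" for c and f :: "'a \<Rightarrow>\<^sub>L 'b"
    by (rule norm_blinfun_bound)
      (auto simp: norm_mult mult.assoc intro!: mult_left_mono norm_blinfun)
  have "dual_scale (inverse c) (dual_scale c f) = f"
    using False by (intro blinfun_eqI) simp
  then have "norm f \<le> inverse (norm c) * norm (dual_scale c f)"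
    using le[of "inverse c" "dual_scale c f"] by (simp add: norm_inverse)
  then show ?thesis
    using le[of c f] False by (simp add: field_simps)
qed

text \<open>Lets Hahn-Banach be applied on the whole type rather than on the subset
  \<open>dual s\<close>.\<close>

lemma normed_space_over_dual_scale:
  "normed_space_over (dual_scale :: 'k::real_normed_field \<Rightarrow> ('a::real_normed_vector \<Rightarrow>\<^sub>L 'k) \<Rightarrow> _)"
  by unfold_locales
    (auto intro!: blinfun_eqI simp: algebra_simps blinfun.add_left blinfun.scaleR_left
      scaleR_conv_of_real norm_dual_scale)

text \<open>
  For \<open>K > 0\<close>, \<open>ball_gauge T K\<close> is the gauge of the convex hull of the image of the unit ball
  and a ball of radius \<open>1 / K\<close>.
\<close>

definition ball_gauge ::
    "('x::real_normed_vector \<Rightarrow>\<^sub>L 'z::real_normed_vector) \<Rightarrow> real \<Rightarrow> 'z \<Rightarrow> real"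
  where "ball_gauge T K z = (INF x. norm x + K * norm (z - T x))"

lemma bdd_below_ball_gauge:
  "0 \<le> K \<Longrightarrow> bdd_below (range (\<lambda>x. norm x + K * norm (z - blinfun_apply T x)))"
  by (rule bdd_belowI2[of _ 0]) simp

lemma ball_gauge_le: "0 \<le> K \<Longrightarrow> ball_gauge T K z \<le> norm x + K * norm (z - T x)"
  unfolding ball_gauge_def by (intro cINF_lower bdd_below_ball_gauge) auto

lemma ball_gauge_le_norm: "0 \<le> K \<Longrightarrow> ball_gauge T K z \<le> K * norm z"
  using ball_gauge_le[of K T z 0] by simp

lemma ball_gauge_image_le: "0 \<le> K \<Longrightarrow> ball_gauge T K (T x) \<le> norm x"
  using ball_gauge_le[of K T "T x" x] by simp

text \<open>Splittings of a vector into \<open>T x\<close> and a remainder can be added and scaled,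
  and their costs behave accordingly. Scaling back by \<open>inverse c\<close> gives the reverse
  inequality.\<close>

lemma seminorm_over_ball_gauge:
  fixes T :: "'x::real_normed_vector \<Rightarrow>\<^sub>L 'z::real_normed_vector"
  assumes sX: "normed_space_over sX" and sZ: "normed_space_over sZ" and K: "0 \<le> K"
    and T: "\<And>c x. T (sX c x) = sZ c (T x)"
  shows "seminorm_over sZ (ball_gauge T K)"
proof -
  interpret X: normed_space_over sX by fact
  interpret Z: normed_space_over sZ by fact
  have le: "ball_gauge T K (sZ c z) \<le> norm c * ball_gauge T K z" if "c \<noteq> 0" for c z
    unfolding ball_gauge_def
  proof (rule INF_le_mult[OF _ bdd_below_ball_gauge[OF K]])
    fix x
    have "norm (sX c x) + K * norm (sZ c z - T (sX c x)) = norm c * (norm x + K * norm (z - T x))"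
      unfolding T Z.scale_right_diff_distrib[symmetric] X.norm_scale Z.norm_scale by (simp add: algebra_simps)
    then show "\<exists>k\<in>UNIV. norm k + K * norm (sZ c z - T k) \<le> norm c * (norm x + K * norm (z - T x))"
      by (intro bexI[of _ "sX c x"]) auto
  qed (use that in auto)
  show ?thesis
    unfolding seminorm_over_def
  proof (intro conjI allI)
    fix y z
    show "ball_gauge T K (y + z) \<le> ball_gauge T K y + ball_gauge T K z"
      unfolding ball_gauge_def
    proof (rule INF_add_le[OF _ bdd_below_ball_gauge[OF K]])
      fix x x'
      have "norm (y + z - T (x + x')) \<le> norm (y - T x) + norm (z - T x')"
        using norm_triangle_ineq[of "y - T x" "z - T x'"] by (simp add: blinfun.add_right algebra_simps)
      then have "norm (x + x') + K * norm (y + z - T (x + x'))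
          \<le> norm x + norm x' + K * (norm (y - T x) + norm (z - T x'))"
        using K by (intro add_mono norm_triangle_ineq mult_left_mono)
      then show "\<exists>k\<in>UNIV. norm k + K * norm (y + z - T k)
          \<le> (norm x + K * norm (y - T x)) + (norm x' + K * norm (z - T x'))"
        by (intro bexI[of _ "x + x'"]) (auto simp: algebra_simps)
    qed simp
  next
    fix c z
    show "ball_gauge T K (sZ c z) = norm c * ball_gauge T K z"
    proof (cases "c = 0")
      case True
      have "0 \<le> ball_gauge T K 0"
        unfolding ball_gauge_def using K by (intro cINF_greatest) auto
      then show ?thesis
        using True ball_gauge_le_norm[OF K, of T 0] by simp
    next
      case False
      have "ball_gauge T K z \<le> norm (inverse c) * ball_gauge T K (sZ c z)"
        using le[of "inverse c" "sZ c z"] False by simp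
      then have "norm c * ball_gauge T K z \<le> ball_gauge T K (sZ c z)"
        unfolding norm_inverse using False by (simp add: field_simps)
      then show ?thesis
        using le[OF False, of z] by simp
    qed
  qed
qed

text \<open>Either \<open>x\<close> has norm at least \<open>1 + \<delta>\<close>, or
  \<open>T x\<close> is still at distance at least \<open>d / 2\<close> from \<open>u\<close>;
  \<open>K\<close> makes the second cost at least \<open>1 + \<delta>\<close> too.\<close>

lemma ball_gauge_gt_1:
  fixes T :: "'x::real_normed_vector \<Rightarrow>\<^sub>L 'z::real_normed_vector"
  assumes "u \<notin> closure (blinfun_apply T ` cball 0 1)"
  obtains K where "0 \<le> K" "1 < ball_gauge T K u"
proof -
  obtain d where d: "0 < d" "\<And>x. norm x \<le> 1 \<Longrightarrow> d \<le> norm (u - T x)"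
    using assms unfolding closure_approachable by (force simp: dist_norm norm_minus_commute not_less)
  \<comment> \<open>Chosen so that moving \<open>x\<close> by \<open>\<delta>\<close> moves
    \<open>T x\<close> by at most \<open>d / 2\<close>; adding 1 avoids division by zero for
    \<open>T = 0\<close>.\<close>
  define \<delta> where "\<delta> = d / (2 * (norm T + 1))"
  have pos: "0 < norm T + 1"
    by (simp add: add_nonneg_pos)
  then have \<delta>: "0 < \<delta>"
    using d(1) by (simp add: \<delta>_def)
  have \<delta>T: "\<delta> * norm T \<le> d / 2"
    using d(1) pos by (simp add: \<delta>_def field_simps)
  define K where "K = 2 * (1 + \<delta>) / d"
  have K: "0 \<le> K" "K * (d / 2) = 1 + \<delta>"
    using d(1) \<delta> by (auto simp: K_def)
  have "1 + \<delta> \<le> norm x + K * norm (u - T x)" for x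
  proof (cases "norm x \<ge> 1 + \<delta>")
    case True
    then show ?thesis
      using K(1) by (simp add: add_increasing2)
  next
    case False
    have "d / 2 \<le> norm (u - T x)"
    proof (cases "norm x \<le> 1")
      case True
      then show ?thesis
        using d(1) d(2)[OF True] by linarith
    next
      case x: False
      then have nx: "1 < norm x" "x \<noteq> 0"
        by auto
      \<comment> \<open>The radial projection to the unit sphere, at distance
        \<open>norm x - 1 < \<delta>\<close> from \<open>x\<close>.\<close>
      define y where "y = x /\<^sub>R norm x"
      have y: "norm y \<le> 1"
        using nx by (simp add: y_def)
      have "x - y = (1 - inverse (norm x)) *\<^sub>R x"
        unfolding y_def scaleR_left_diff_distrib by simp
      then have "norm (x - y) = (1 - inverse (norm x)) * norm x"
        using nx by (simp add: inverse_le_1_iff)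
      also have "\<dots> = norm x - 1"
        using nx by (simp add: left_diff_distrib)
      finally have "norm (x - y) \<le> \<delta>"
        using False by simp
      then have "norm (T x - T y) \<le> norm T * \<delta>"
        using norm_blinfun[of T "x - y"] mult_left_mono[of "norm (x - y)" \<delta> "norm T"]
        by (simp add: blinfun.diff_right)
      moreover have "d \<le> norm (u - T x) + norm (T x - T y)"
        using d(2)[OF y] norm_triangle_ineq[of "u - T x" "T x - T y"] by simp
      ultimately show ?thesis
        using \<delta>T by (simp add: mult.commute)
    qed
    then have "1 + \<delta> \<le> K * norm (u - T x)"
      unfolding K(2)[symmetric] using K(1) by (intro mult_left_mono)
    then show ?thesis
      by (simp add: add_increasing)
  qed
  then have "1 + \<delta> \<le> ball_gauge T K u"
    unfolding ball_gauge_def by (intro cINF_greatest) auto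
  then show thesis
    using that[of K] K(1) \<delta> by linarith
qed

text \<open>The weak-star limit \<open>u\<close> is shown to be a norm limit, so the same
  \<open>u\<close> witnesses membership in \<open>QNA\<close>.\<close>

lemma wstar_QNA_subset_QNA:
  fixes sX :: "'k::real_normed_field \<Rightarrow> 'x::real_normed_vector \<Rightarrow> 'x"
    and sY :: "'k \<Rightarrow> 'y::real_normed_vector \<Rightarrow> 'y"
  assumes sX: "normed_space_over sX" and "norming (dual_scale :: 'k \<Rightarrow> ('y \<Rightarrow>\<^sub>L 'k) \<Rightarrow> _)"
    and "reflexive sY"
  shows "wstar_QNA sX sY \<subseteq> QNA sX sY"
proof
  fix T assume "T \<in> wstar_QNA sX sY"
  then obtain u where T: "T \<in> ops_to_dual sX sY" and u: "u \<in> dual sY" "norm u = norm T"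
    and wstar: "u \<in> weak_star_topology sY closure_of (blinfun_apply T ` cball 0 1)"
    unfolding wstar_QNA_def by blast
  have "u \<in> closure (blinfun_apply T ` cball 0 1)"
  proof (rule ccontr)
    assume "u \<notin> closure (blinfun_apply T ` cball 0 1)"
    then obtain K where K: "0 \<le> K" "1 < ball_gauge T K u"
      using ball_gauge_gt_1 by blast
    have "seminorm_over dual_scale (ball_gauge T K)"
      using T by (intro seminorm_over_ball_gauge[OF sX normed_space_over_dual_scale K(1)])
        (simp add: ops_to_dual_def)
    then obtain \<phi> where \<phi>: "\<And>f g. \<phi> (f + g) = \<phi> f + \<phi> g" "\<And>c f. \<phi> (dual_scale c f) = c * \<phi> f"
      "\<And>f. norm (\<phi> f) \<le> ball_gauge T K f" "\<phi> u = of_real (ball_gauge T K u)"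
      using assms(2) unfolding norming_def by blast
    \<comment> \<open>The ball of radius \<open>1 / K\<close> in the gauge is what makes
      \<open>\<phi>\<close> bounded.\<close>
    have "norm (\<phi> f) \<le> K * norm f" for f
      using \<phi>(3)[of f] ball_gauge_le_norm[OF K(1), of T f] by linarith
    then have "\<phi> \<in> bidual sY"
      unfolding bidual_def using \<phi>(1,2) by blast
    then obtain y where y: "\<And>f. f \<in> dual sY \<Longrightarrow> \<phi> f = blinfun_apply f y"
      using \<open>reflexive sY\<close> unfolding reflexive_def by blast
    \<comment> \<open>The gauge is at most 1 on the image of the unit ball but exceeds 1 at
      \<open>u\<close>.\<close>
    have "norm (T x y) \<le> 1" if "norm x \<le> 1" for x
    proof -
      have "T x y = \<phi> (T x)"
        using T by (simp add: y ops_to_dual_def)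
      then show ?thesis
        using \<phi>(3)[of "T x"] ball_gauge_image_le[OF K(1), of T x] that by simp
    qed
    then have "blinfun_apply ` blinfun_apply T ` cball 0 1 \<subseteq> {g. norm (g y) \<le> 1}"
      by auto
    \<comment> \<open>Evaluation at \<open>y\<close> is continuous for pointwise convergence, so the
      bound passes to \<open>u\<close>.\<close>
    moreover have "closed {g :: 'y \<Rightarrow> 'k. norm (g y) \<le> 1}"
      by (intro closed_Collect_le continuous_on_norm continuous_on_product_coordinates continuous_on_const)
    ultimately have "norm (u y) \<le> 1"
      using closure_of_weak_star_subset[OF wstar] closure_minimal by blast
    moreover have "u y = of_real (ball_gauge T K u)"
      using y[OF u(1)] \<phi>(4) by simp
    ultimately show False
      using K(2) by simp
  qed
  then show "T \<in> QNA sX sY"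
    using T u unfolding QNA_def by blast
qed

theorem mainTheorem7:
  shows
    "(\<forall>(sX :: real \<Rightarrow> 'x::banach \<Rightarrow> 'x) (sY :: real \<Rightarrow> 'y::banach \<Rightarrow> 'y).
        normed_space_over sX \<longrightarrow> normed_space_over sY \<longrightarrow>
          (reflexive sX \<longrightarrow> NA sX sY = QNA sX sY \<and> QNA sX sY = wstar_QNA sX sY) \<and>
          (reflexive sY \<longrightarrow> QNA sX sY = wstar_QNA sX sY)) \<and>
     (\<forall>(sX :: complex \<Rightarrow> 'x::banach \<Rightarrow> 'x) (sY :: complex \<Rightarrow> 'y::banach \<Rightarrow> 'y).
        normed_space_over sX \<longrightarrow> normed_space_over sY \<longrightarrow>
          (reflexive sX \<longrightarrow> NA sX sY = QNA sX sY \<and> QNA sX sY = wstar_QNA sX sY) \<and>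
          (reflexive sY \<longrightarrow> QNA sX sY = wstar_QNA sX sY))"
proof (intro conjI allI impI)
  fix sX :: "real \<Rightarrow> 'x \<Rightarrow> 'x" and sY :: "real \<Rightarrow> 'y \<Rightarrow> 'y"
  assume sX: "normed_space_over sX"
  \<comment> \<open>For reflexive \<open>sX\<close> these close the cycle \<open>NA\<close>,
    \<open>QNA\<close>, \<open>wstar_QNA\<close>, \<open>NA\<close> of inclusions.\<close>
  note incl = NA_subset_QNA[of sX sY] QNA_subset_wstar_QNA[of sX sY]
  {
    assume "reflexive sX"
    then have "wstar_QNA sX sY \<subseteq> NA sX sY"
      using sX by (intro wstar_QNA_subset_NA norming_real)
    then show "NA sX sY = QNA sX sY" "QNA sX sY = wstar_QNA sX sY"
      using incl by auto
  next
    assume "reflexive sY"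
    then have "wstar_QNA sX sY \<subseteq> QNA sX sY"
      using sX by (intro wstar_QNA_subset_QNA norming_real normed_space_over_dual_scale)
    then show "QNA sX sY = wstar_QNA sX sY"
      using incl by auto
  }
next
  fix sX :: "complex \<Rightarrow> 'x \<Rightarrow> 'x" and sY :: "complex \<Rightarrow> 'y \<Rightarrow> 'y"
  assume sX: "normed_space_over sX"
  note incl = NA_subset_QNA[of sX sY] QNA_subset_wstar_QNA[of sX sY]
  {
    assume "reflexive sX"
    then have "wstar_QNA sX sY \<subseteq> NA sX sY"
      using sX by (intro wstar_QNA_subset_NA norming_complex)
    then show "NA sX sY = QNA sX sY" "QNA sX sY = wstar_QNA sX sY"
      using incl by auto
  next
    assume "reflexive sY"
    then have "wstar_QNA sX sY \<subseteq> QNA sX sY"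
      using sX by (intro wstar_QNA_subset_QNA norming_complex normed_space_over_dual_scale)
    then show "QNA sX sY = wstar_QNA sX sY"
      using incl by auto
  }
qed

end
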